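(* Let $\Phi:\mathbb{R}^n \rightrightarrows \mathbb{R}^m$ be a polyhedral sublinear mapping and let $\mathcal{L}\subseteq \mathbb{R}^m$ be a linear subspace. Then for all $b\in \mathrm{Im}(\Phi)$ and all $u\in \mathrm{dom}(\Phi)$ $$\mathrm{dist}(u,\Phi^{-1}(b)) \le \mathcal{H}(\Phi\vert\mathcal{L})\cdot \mathrm{dist}_{\mathcal{L}}(b,\Phi(u)),$$ where the right-hand side is understood to be $+\infty$ whenever $\mathrm{dist}_{\mathcal{L}}(b,\Phi(u))=+\infty$. Furthermore, this bound is tight: if $\mathcal{H}(\Phi\vert\mathcal{L})>0$ then there exist $b\in \mathrm{Im}(\Phi)$ and $u\in\mathrm{dom}(\Phi)$ such that $0<\mathrm{dist}_{\mathcal{L}}(b,\Phi(u))<\infty$ and $$\mathrm{dist}(u,\Phi^{-1}(b)) = \mathcal{H}(\Phi\vert\mathcal{L})\cdot \mathrm{dist}_{\mathcal{L}}(b,\Phi(u)).$$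
   Context: $\mathbb{R}^n$ and $\mathbb{R}^m$ are each endowed with an arbitrary norm, denoted $\|\cdot\|$. A set-valued mapping $\Phi:\mathbb{R}^n\rightrightarrows\mathbb{R}^m$ assigns to each $x\in\mathbb{R}^n$ a set $\Phi(x)\subseteq\mathbb{R}^m$; its graph is $\mathrm{graph}(\Phi)=\{(x,y)\in\mathbb{R}^n\times\mathbb{R}^m: y\in\Phi(x)\}$. $\Phi$ is a polyhedral sublinear mapping if $\mathrm{graph}(\Phi)$ is a polyhedral convex cone. Conversely, a polyhedral convex cone $K\subseteq\mathbb{R}^n\times\mathbb{R}^m$ defines the polyhedral sublinear mapping $\Phi_K$ by $y\in\Phi_K(x)\Leftrightarrow (x,y)\in K$. $\mathrm{dom}(\Phi)=\{x\in\mathbb{R}^n: \Phi(x)\neq\emptyset\}$, $\mathrm{Im}(\Phi)=\{y\in\mathbb{R}^m: (x,y)\in\mathrm{graph}(\Phi)\text{ for some }x\in\mathbb{R}^n\}$, and $\Phi^{-1}(y)=\{x\in\mathbb{R}^n: y\in\Phi(x)\}$. $\Phi$ is relatively surjective if $\mathrm{Im}(\Phi)$ is a linear subspace of $\mathbb{R}^m$. For a linear subspace $\mathcal{L}\subseteq\mathbb{R}^m$, $$\|\Phi^{-1}\vert\mathcal{L}\| := \max_{y\in\mathrm{Im}(\Phi)\cap\mathcal{L},\ \|y\|\le 1}\ \min_{x\in\Phi^{-1}(y)}\|x\|.$$ For a polyhedral convex cone $K\subseteq\mathbb{R}^n\times\mathbb{R}^m$ and $(u,v)\in K$, the tangent cone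 is $T_K(u,v)=\{(x,y)\in\mathbb{R}^n\times\mathbb{R}^m: (u,v)+t(x,y)\in K\text{ for some }t>0\}$, and $\mathcal{T}(K)=\{T_K(u,v):(u,v)\in K\}$ (a finite collection). Let $$\mathfrak{S}(\Phi)=\{T\in\mathcal{T}(\mathrm{graph}(\Phi)): \Phi_T\text{ is relatively surjective}\},\qquad \mathcal{H}(\Phi\vert\mathcal{L})=\max_{T\in\mathfrak{S}(\Phi)}\|\Phi_T^{-1}\vert\mathcal{L}\|.$$ Distances: $\mathrm{dist}(u,S)=\inf\{\|u-x\|:x\in S\}$ and $\mathrm{dist}_{\mathcal{L}}(b,S)=\inf\{\|b-y\|: y\in S,\ b-y\in\mathcal{L}\}$ (equal to $+\infty$ if no such $y$ exists). *)

theory Defs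
  imports "HOL-Analysis.Analysis"
begin

text \<open>
  The spaces carry arbitrary norms, which need not be the Euclidean norm of the type class.
\<close>

definition is_norm :: "('a::real_vector \<Rightarrow> real) \<Rightarrow> bool" where
  "is_norm N \<longleftrightarrow>
     (\<forall>x. 0 \<le> N x) \<and>
     (\<forall>x. N x = 0 \<longleftrightarrow> x = 0) \<and>
     (\<forall>c x. N (c *\<^sub>R x) = \<bar>c\<bar> * N x) \<and>
     (\<forall>x y. N (x + y) \<le> N x + N y)"

definition sv_graph :: "('a \<Rightarrow> 'b set) \<Rightarrow> ('a \<times> 'b) set" where
  "sv_graph \<Phi> = {(x, y). y \<in> \<Phi> x}"

definition sv_of :: "('a \<times> 'b) set \<Rightarrow> 'a \<Rightarrow> 'b set" where
  "sv_of K x = {y. (x, y) \<in> K}"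

definition sv_dom :: "('a \<Rightarrow> 'b set) \<Rightarrow> 'a set" where
  "sv_dom \<Phi> = {x. \<Phi> x \<noteq> {}}"

definition sv_Im :: "('a \<Rightarrow> 'b set) \<Rightarrow> 'b set" where
  "sv_Im \<Phi> = {y. \<exists>x. (x, y) \<in> sv_graph \<Phi>}"

definition sv_inv :: "('a \<Rightarrow> 'b set) \<Rightarrow> 'b \<Rightarrow> 'a set" where
  "sv_inv \<Phi> y = {x. y \<in> \<Phi> x}"

definition polyhedral_convex_cone :: "'a::euclidean_space set \<Rightarrow> bool" where
  "polyhedral_convex_cone K \<longleftrightarrow> polyhedron K \<and> convex_cone K"

definition polyhedral_sublinear ::
    "('a::euclidean_space \<Rightarrow> 'b::euclidean_space set) \<Rightarrow> bool" where
  "polyhedral_sublinear \<Phi> \<longleftrightarrow> polyhedral_convex_cone (sv_graph \<Phi>)"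

definition relatively_surjective :: "('a \<Rightarrow> 'b::real_vector set) \<Rightarrow> bool" where
  "relatively_surjective \<Phi> \<longleftrightarrow> subspace (sv_Im \<Phi>)"

definition tangent_cone :: "'a::real_vector set \<Rightarrow> 'a \<Rightarrow> 'a set" where
  "tangent_cone K p = {w. \<exists>t>0. p + t *\<^sub>R w \<in> K}"

definition tangent_cones :: "'a::real_vector set \<Rightarrow> 'a set set" where
  "tangent_cones K = tangent_cone K ` K"

definition rs_tangent_cones ::
    "('a::real_vector \<Rightarrow> 'b::real_vector set) \<Rightarrow> ('a \<times> 'b) set set" where
  "rs_tangent_cones \<Phi> =
     {T \<in> tangent_cones (sv_graph \<Phi>). relatively_surjective (sv_of T)}"

text \<open>
  In the next two definitions the extrema are taken in \<^typ>\<open>ereal\<close>, so that they are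
  meaningful without any boundedness side condition. The index sets are nonempty and the suprema
  and infima are attained for polyhedral sublinear mappings; SUP and INF are then max and min.
\<close>

definition inv_norm_on ::
    "('a \<Rightarrow> real) \<Rightarrow> ('b \<Rightarrow> real) \<Rightarrow> ('a \<Rightarrow> 'b set) \<Rightarrow> 'b set \<Rightarrow> ereal" where
  "inv_norm_on N M \<Phi> L =
     (SUP y \<in> {y \<in> sv_Im \<Phi> \<inter> L. M y \<le> 1}. INF x \<in> sv_inv \<Phi> y. ereal (N x))"

definition hoffman_const ::
    "('a::real_vector \<Rightarrow> real) \<Rightarrow> ('b::real_vector \<Rightarrow> real) \<Rightarrow> ('a \<Rightarrow> 'b set) \<Rightarrow> 'b set \<Rightarrow> ereal" where
  "hoffman_const N M \<Phi> L = (SUP T \<in> rs_tangent_cones \<Phi>. inv_norm_on N M (sv_of T) L)"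

definition dist_set :: "('a::real_vector \<Rightarrow> real) \<Rightarrow> 'a \<Rightarrow> 'a set \<Rightarrow> ereal" where
  "dist_set N u S = (INF x \<in> S. ereal (N (u - x)))"

text \<open>The infimum over the empty set is \<open>\<infinity>\<close> in \<^typ>\<open>ereal\<close>.\<close>

definition dist_along ::
    "('b::real_vector \<Rightarrow> real) \<Rightarrow> 'b set \<Rightarrow> 'b \<Rightarrow> 'b set \<Rightarrow> ereal" where
  "dist_along M L b S = (INF y \<in> {y \<in> S. b - y \<in> L}. ereal (M (b - y)))"

end

theory Submission
  imports Defs
begin

text \<open>
  The error bound comes from linear programming duality. Fix \<open>y\<close> in \<open>\<Phi> u\<close> with \<open>b - y\<close> in \<open>L\<close>, and let
  \<open>x\<close> be a point of the inverse image of \<open>b\<close> nearest to \<open>u\<close>. Separating the ball of radius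
  \<open>N (x - u)\<close> from the inverse image and extending the separating functional by Farkas' lemma
  (\<open>extend_nonneg_functional_from_slice\<close>) yields a functional \<open>(\<xi>, \<eta>)\<close>, nonnegative on the tangent
  cone of the graph at \<open>(x, b)\<close>, which certifies that nothing in this cone over \<open>b - y\<close> is shorter
  than \<open>x - u\<close>. If this cone were relatively surjective, the norm of its inverse on \<open>L\<close> would be
  at least the ratio of \<open>N (x - u)\<close> to \<open>M (b - y)\<close>, which is the bound.

  In general it is not, and the main point is to replace it by one that is
  (\<open>relatively_surjective_tangent_cone_with_functional\<close>). Only \<open>\<xi>\<close> has to be kept. A maximal tangent
  cone on which some \<open>(\<xi>, \<eta>)\<close> is nonnegative must be relatively surjective, because otherwise
  \<open>\<eta>\<close> can be tilted until the functional vanishes on a new face, and moving the base point into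
  that face enlarges the tangent cone. Polyhedrality is used through finitely generated cones
  (the Minkowski-Weyl theorem) and the finiteness of the set of tangent cones.

  For tightness, the Hoffman constant \<open>r\<close> is attained by some tangent cone \<open>T\<close> and some \<open>y\<close> in its image
  (\<open>hoffman_const_attained\<close>), as there are finitely many tangent cones and the least norm of a
  preimage is continuous on a subspace. At the base point \<open>(u, v)\<close> of \<open>T\<close> a small step \<open>t\<close> from
  \<open>v\<close> in the direction \<open>y\<close> gives a \<open>b\<close> whose inverse image is at distance at least \<open>r * t\<close> from \<open>u\<close>,
  and the error bound turns this into an equality.
\<close>

section \<open>Polyhedral convex cones\<close>

definition dual_cone :: "'a::real_inner set \<Rightarrow> 'a set" where
  "dual_cone A = {w. \<forall>a\<in>A. 0 \<le> a \<bullet> w}"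

lemma dual_coneI: "(\<And>a. a \<in> A \<Longrightarrow> 0 \<le> a \<bullet> w) \<Longrightarrow> w \<in> dual_cone A"
  by (simp add: dual_cone_def)

lemma dual_coneD: "w \<in> dual_cone A \<Longrightarrow> a \<in> A \<Longrightarrow> 0 \<le> a \<bullet> w"
  by (simp add: dual_cone_def)

lemma convex_cone_dual_cone: "convex_cone (dual_cone A)"
  by (auto simp: convex_cone_iff dual_cone_def inner_add_right)

lemma dual_cone_convex_cone_hull: "dual_cone (convex_cone hull A) = dual_cone A"
proof
  show "dual_cone (convex_cone hull A) \<subseteq> dual_cone A"
    by (auto simp: dual_cone_def hull_inc)
  show "dual_cone A \<subseteq> dual_cone (convex_cone hull A)"
  proof
    fix w assume w: "w \<in> dual_cone A"
    have "convex_cone hull A \<subseteq> {x. w \<bullet> x \<ge> 0}"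
      using w by (intro hull_minimal convex_cone_halfspace_ge) (auto simp: dual_cone_def inner_commute)
    then show "w \<in> dual_cone (convex_cone hull A)"
      by (auto simp: dual_cone_def inner_commute)
  qed
qed

text \<open>
  Scaling by positive factors turns any hyperplane that strictly separates a point from a cone
  into one through the origin.
\<close>

lemma separate_point_from_closed_convex_cone:
  fixes C :: "'a::euclidean_space set"
  assumes "closed C" "convex_cone C" "z \<notin> C"
  obtains c where "c \<in> dual_cone C" "c \<bullet> z < 0"
proof -
  obtain a b where ab: "a \<bullet> z < b" "\<forall>x\<in>C. a \<bullet> x > b"
    using separating_hyperplane_closed_point[of C z] assms by (auto simp: convex_cone_def)
  have "b < 0"
    using ab(2) convex_cone_contains_0[OF assms(2)] by force
  have "0 \<le> a \<bullet> x" if x: "x \<in> C" for x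
  proof (rule ccontr)
    assume neg: "\<not> 0 \<le> a \<bullet> x"
    have "(b / (a \<bullet> x)) *\<^sub>R x \<in> C"
      using neg \<open>b < 0\<close> by (intro convex_cone_scaleR assms x) (simp add: divide_nonpos_neg)
    then have "a \<bullet> ((b / (a \<bullet> x)) *\<^sub>R x) > b"
      using ab(2) by blast
    with neg show False by simp
  qed
  then have "a \<in> dual_cone C"
    by (simp add: dual_cone_def inner_commute)
  moreover have "a \<bullet> z < 0"
    using ab(1) \<open>b < 0\<close> by linarith
  ultimately show thesis by (rule that)
qed

lemma dual_cone_dual_cone_finite:
  fixes A :: "'a::euclidean_space set"
  assumes "finite A"
  shows "dual_cone (dual_cone A) = convex_cone hull A"
proof
  show "dual_cone (dual_cone A) \<subseteq> convex_cone hull A"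
  proof
    fix w assume w: "w \<in> dual_cone (dual_cone A)"
    show "w \<in> convex_cone hull A"
    proof (rule ccontr)
      assume "w \<notin> convex_cone hull A"
      then obtain c where "c \<in> dual_cone (convex_cone hull A)" "c \<bullet> w < 0"
        using separate_point_from_closed_convex_cone closed_convex_cone_hull[OF assms]
          convex_cone_convex_cone_hull by metis
      with w show False
        by (force simp: dual_cone_convex_cone_hull dest: dual_coneD)
    qed
  qed
  have "A \<subseteq> dual_cone (dual_cone A)"
    by (auto simp: dual_cone_def inner_commute)
  then show "convex_cone hull A \<subseteq> dual_cone (dual_cone A)"
    by (simp add: hull_minimal convex_cone_dual_cone)
qed

text \<open>
  In a polyhedral description of a cone all right-hand sides may be taken to be \<open>0\<close>: the origin
  makes them nonnegative, and scaling makes the left-hand sides nonpositive.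
\<close>

lemma polyhedral_convex_cone_iff_dual_cone:
  "polyhedral_convex_cone K \<longleftrightarrow> (\<exists>A. finite A \<and> K = dual_cone A)"
proof
  assume K: "polyhedral_convex_cone K"
  then have cone: "convex_cone K" by (simp add: polyhedral_convex_cone_def)
  obtain F where F: "finite F" "K = \<Inter>F" "\<forall>h\<in>F. \<exists>a b. a \<noteq> 0 \<and> h = {x. a \<bullet> x \<le> b}"
    using K by (auto simp: polyhedral_convex_cone_def polyhedron_def)
  then obtain a b where h: "\<And>h. h \<in> F \<Longrightarrow> h = {x. a h \<bullet> x \<le> b h}"
    by metis
  have "K = dual_cone ((\<lambda>h. - a h) ` F)"
  proof
    show "K \<subseteq> dual_cone ((\<lambda>h. - a h) ` F)"
    proof
      fix x assume x: "x \<in> K"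
      have "a h \<bullet> x \<le> 0" if hF: "h \<in> F" for h
      proof (rule ccontr)
        assume pos: "\<not> a h \<bullet> x \<le> 0"
        define t where "t = (\<bar>b h\<bar> + 1) / (a h \<bullet> x)"
        have "t *\<^sub>R x \<in> K"
          using pos by (intro convex_cone_scaleR cone x) (simp add: t_def)
        then have "a h \<bullet> (t *\<^sub>R x) \<le> b h"
          using F(2) hF h[OF hF] by blast
        with pos show False by (simp add: t_def)
      qed
      then show "x \<in> dual_cone ((\<lambda>h. - a h) ` F)"
        by (auto simp: dual_cone_def)
    qed
    show "dual_cone ((\<lambda>h. - a h) ` F) \<subseteq> K"
    proof
      fix x assume x: "x \<in> dual_cone ((\<lambda>h. - a h) ` F)"
      have "x \<in> h" if hF: "h \<in> F" for h
      proof -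
        have "0 \<in> h"
          using convex_cone_contains_0[OF cone] F(2) hF by blast
        then have "0 \<le> b h" using h[OF hF] by (metis inner_zero_right mem_Collect_eq)
        moreover have "a h \<bullet> x \<le> 0"
          using x hF by (auto simp: dual_cone_def)
        ultimately show ?thesis
          using h[OF hF] by (metis dual_order.trans mem_Collect_eq)
      qed
      then show "x \<in> K" using F(2) by blast
    qed
  qed
  with F(1) show "\<exists>A. finite A \<and> K = dual_cone A" by blast
next
  assume "\<exists>A. finite A \<and> K = dual_cone A"
  then obtain A where A: "finite A" "K = dual_cone A" by blast
  have "dual_cone A = \<Inter>((\<lambda>a. {x. a \<bullet> x \<ge> 0}) ` A)"
    by (auto simp: dual_cone_def)
  then have "polyhedron K"
    using A by (auto intro!: polyhedron_Inter polyhedron_halfspace_ge)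
  then show "polyhedral_convex_cone K"
    by (simp add: polyhedral_convex_cone_def A convex_cone_dual_cone)
qed

text \<open>
  The Minkowski-Weyl theorem for cones. That finitely generated cones are polyhedral is
  \<open>polyhedron_convex_cone_hull\<close>; the converse follows by applying this to the dual cone and
  dualising back.
\<close>

lemma polyhedral_convex_cone_iff_finitely_generated:
  "polyhedral_convex_cone K \<longleftrightarrow> (\<exists>G. finite G \<and> K = convex_cone hull G)"
proof
  assume "polyhedral_convex_cone K"
  then obtain A where A: "finite A" "K = dual_cone A"
    by (auto simp: polyhedral_convex_cone_iff_dual_cone)
  have "polyhedral_convex_cone (convex_cone hull A)"
    by (simp add: A polyhedral_convex_cone_def polyhedron_convex_cone_hull
        convex_cone_convex_cone_hull)
  then obtain B where B: "finite B" "convex_cone hull A = dual_cone B"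
    by (auto simp: polyhedral_convex_cone_iff_dual_cone)
  have "K = convex_cone hull B"
    using A B by (metis dual_cone_convex_cone_hull dual_cone_dual_cone_finite)
  with B(1) show "\<exists>G. finite G \<and> K = convex_cone hull G" by blast
next
  assume "\<exists>G. finite G \<and> K = convex_cone hull G"
  then show "polyhedral_convex_cone K"
    by (auto simp: polyhedral_convex_cone_def polyhedron_convex_cone_hull
        convex_cone_convex_cone_hull)
qed

lemma closed_polyhedral_convex_cone: "polyhedral_convex_cone K \<Longrightarrow> closed K"
  by (simp add: polyhedral_convex_cone_def polyhedron_imp_closed)

lemma polyhedral_convex_cone_linear_image:
  assumes "polyhedral_convex_cone K" "linear f"
  shows "polyhedral_convex_cone (f ` K)"
  using assms unfolding polyhedral_convex_cone_iff_finitely_generated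
  by (metis convex_cone_hull_linear_image finite_imageI)

text \<open>
  Farkas' lemma with a parameter. Polyhedrality is essential: the functionals \<open>\<xi>\<close> for which
  \<open>\<eta>\<close> exists form a projection of the dual cone, and it is finite generation that
  keeps this projection closed.
\<close>

lemma extend_nonneg_functional_from_slice:
  fixes T :: "('a::euclidean_space \<times> 'b::euclidean_space) set"
  assumes "polyhedral_convex_cone T" and nonneg: "\<And>z. (z, 0) \<in> T \<Longrightarrow> 0 \<le> \<xi> \<bullet> z"
  obtains \<eta> where "(\<xi>, \<eta>) \<in> dual_cone T"
proof -
  obtain A where A: "finite A" "T = dual_cone A"
    using assms(1) by (auto simp: polyhedral_convex_cone_iff_dual_cone)
  have "\<xi> \<in> dual_cone (dual_cone (fst ` A))"
  proof (rule dual_coneI)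
    fix z assume "z \<in> dual_cone (fst ` A)"
    then have "(z, 0) \<in> T"
      by (auto simp: A dual_cone_def inner_prod_def)
    from nonneg[OF this] show "0 \<le> z \<bullet> \<xi>" by (simp add: inner_commute)
  qed
  then have "\<xi> \<in> fst ` (convex_cone hull A)"
    by (simp add: dual_cone_dual_cone_finite A(1) convex_cone_hull_linear_image linear_fst)
  then obtain \<eta> where "(\<xi>, \<eta>) \<in> convex_cone hull A" by force
  then have "(\<xi>, \<eta>) \<in> dual_cone T"
    by (simp add: A dual_cone_dual_cone_finite)
  then show thesis by (rule that)
qed

section \<open>Tangent cones\<close>

text \<open>
  Tangent cones of a polyhedral cone are cut out by the constraints active at the base point.
  Hence they are polyhedral, and there are only finitely many of them.
\<close>

lemma tangent_cone_dual_cone: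
  fixes A :: "'a::euclidean_space set"
  assumes "finite A" "p \<in> dual_cone A"
  shows "tangent_cone (dual_cone A) p = dual_cone {a \<in> A. a \<bullet> p = 0}"
proof
  show "tangent_cone (dual_cone A) p \<subseteq> dual_cone {a \<in> A. a \<bullet> p = 0}"
  proof
    fix w assume "w \<in> tangent_cone (dual_cone A) p"
    then obtain t where t: "t > 0" "p + t *\<^sub>R w \<in> dual_cone A"
      by (auto simp: tangent_cone_def)
    show "w \<in> dual_cone {a \<in> A. a \<bullet> p = 0}"
    proof (rule dual_coneI)
      fix a assume "a \<in> {a \<in> A. a \<bullet> p = 0}"
      then show "0 \<le> a \<bullet> w"
        using dual_coneD[OF t(2), of a] t(1) by (simp add: inner_add_right zero_le_mult_iff)
    qed
  qed
  show "dual_cone {a \<in> A. a \<bullet> p = 0} \<subseteq> tangent_cone (dual_cone A) p"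
  proof
    fix w assume w: "w \<in> dual_cone {a \<in> A. a \<bullet> p = 0}"
    \<comment> \<open>Inactive constraints survive a short step; the finitely many step bounds have a minimum.\<close>
    define t where
      "t = Min (insert 1 ((\<lambda>a. (a \<bullet> p) / (\<bar>a \<bullet> w\<bar> + 1)) ` {a \<in> A. a \<bullet> p > 0}))"
    have "t > 0"
      using assms(1) by (auto simp: t_def intro!: divide_pos_pos)
    have "0 \<le> a \<bullet> (p + t *\<^sub>R w)" if a: "a \<in> A" for a
    proof (cases "a \<bullet> p = 0")
      case True
      then show ?thesis
        using w a \<open>t > 0\<close> by (simp add: dual_cone_def inner_add_right)
    next
      case False
      then have pos: "a \<bullet> p > 0"
        using dual_coneD[OF assms(2) a] by linarith
      then have "t \<le> (a \<bullet> p) / (\<bar>a \<bullet> w\<bar> + 1)"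
        unfolding t_def using assms(1) a by (intro Min_le) auto
      then have "t * (\<bar>a \<bullet> w\<bar> + 1) \<le> a \<bullet> p"
        by (simp add: field_simps)
      then have "t * \<bar>a \<bullet> w\<bar> + t \<le> a \<bullet> p"
        by (simp add: distrib_left)
      moreover have "t * (- (a \<bullet> w)) \<le> t * \<bar>a \<bullet> w\<bar>"
        using \<open>t > 0\<close> by (intro mult_left_mono) auto
      ultimately show ?thesis
        using \<open>t > 0\<close> by (simp add: inner_add_right)
    qed
    then show "w \<in> tangent_cone (dual_cone A) p"
      using \<open>t > 0\<close> by (auto simp: tangent_cone_def dual_cone_def)
  qed
qed

lemma polyhedral_tangent_cone:
  assumes "polyhedral_convex_cone K" "p \<in> K"
  shows "polyhedral_convex_cone (tangent_cone K p)"
proof -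
  obtain A where A: "finite A" "K = dual_cone A"
    using assms(1) by (auto simp: polyhedral_convex_cone_iff_dual_cone)
  have "finite {a \<in> A. a \<bullet> p = 0}" using A(1) by simp
  then show ?thesis
    using tangent_cone_dual_cone[of A p] A assms(2) polyhedral_convex_cone_iff_dual_cone by metis
qed

lemma finite_tangent_cones:
  assumes "polyhedral_convex_cone K"
  shows "finite (tangent_cones K)"
proof -
  obtain A where A: "finite A" "K = dual_cone A"
    using assms(1) by (auto simp: polyhedral_convex_cone_iff_dual_cone)
  have "tangent_cones K \<subseteq> dual_cone ` Pow A"
    by (auto simp: tangent_cones_def A tangent_cone_dual_cone)
  then show ?thesis
    using A(1) by (meson finite_Pow_iff finite_imageI finite_subset)
qed

lemma diff_in_tangent_cone: "x \<in> K \<Longrightarrow> x - p \<in> tangent_cone K p"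
  unfolding tangent_cone_def by (auto intro!: exI[of _ 1])

text \<open>
  Tangent cones grow when the base point moves from an end of a segment in \<open>K\<close> to its midpoint:
  averaging \<open>q + t *\<^sub>R w\<close> with the far end of the segment gives a point of \<open>K\<close> that lies from the
  midpoint in the direction \<open>w\<close>.
\<close>

lemma tangent_cone_mono_along_segment:
  assumes "convex K" "q \<in> K" "q + (2 * e) *\<^sub>R g \<in> K"
  shows "tangent_cone K q \<subseteq> tangent_cone K (q + e *\<^sub>R g)"
proof
  fix w assume "w \<in> tangent_cone K q"
  then obtain t where t: "t > 0" "q + t *\<^sub>R w \<in> K"
    by (auto simp: tangent_cone_def)
  have "(1/2) *\<^sub>R (q + (2 * e) *\<^sub>R g) + (1/2) *\<^sub>R (q + t *\<^sub>R w) \<in> K"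
    using assms t by (intro convexD) auto
  moreover have "(1/2) *\<^sub>R (q + (2 * e) *\<^sub>R g) + (1/2) *\<^sub>R (q + t *\<^sub>R w)
      = (q + e *\<^sub>R g) + (t/2) *\<^sub>R w"
    by (simp add: algebra_simps flip: scaleR_2)
  ultimately show "w \<in> tangent_cone K (q + e *\<^sub>R g)"
    using t(1) unfolding tangent_cone_def by (auto intro!: exI[of _ "t/2"])
qed

lemma sv_Im_eq_snd_image: "sv_Im (sv_of T) = snd ` T"
  by (force simp: sv_Im_def sv_graph_def sv_of_def)

text \<open>
  If the image of \<open>T\<close> is not a subspace, some \<open>c\<close> is nonnegative on the image without vanishing
  there. Subtracting a multiple of \<open>(0, c)\<close> from \<open>(\<xi>, \<eta>)\<close> leaves \<open>\<xi>\<close> alone, and the largest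
  multiple that keeps the functional nonnegative on \<open>T\<close> makes it vanish at a generator \<open>g\<close>
  with \<open>c\<close> positive at \<open>snd g\<close>. Such a generator has no negative in \<open>T\<close>, so the functional has
  reached a face of \<open>T\<close> larger than the lineality space.
\<close>

lemma tilt_functional_to_new_face:
  fixes T :: "('a::euclidean_space \<times> 'b::euclidean_space) set"
  assumes T: "polyhedral_convex_cone T" and dual: "(\<xi>, \<eta>) \<in> dual_cone T"
    and not_subspace: "\<not> subspace (snd ` T)"
  obtains g \<eta>' where "g \<in> T" "- g \<notin> T" "(\<xi>, \<eta>') \<in> dual_cone T" "(\<xi>, \<eta>') \<bullet> g = 0"
proof -
  obtain G where G: "finite G" "T = convex_cone hull G"
    using T by (auto simp: polyhedral_convex_cone_iff_finitely_generated)
  have "polyhedral_convex_cone (snd ` T)"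
    by (rule polyhedral_convex_cone_linear_image[OF T linear_snd])
  then have cl: "closed (snd ` T)" and cone: "convex_cone (snd ` T)"
    by (auto simp: closed_polyhedral_convex_cone polyhedral_convex_cone_def)
  from not_subspace obtain y where y: "y \<in> snd ` T" "- y \<notin> snd ` T"
    using cone by (auto simp: subspace_convex_cone_symmetric)
  obtain c where c: "c \<in> dual_cone (snd ` T)" "c \<bullet> (- y) < 0"
    using separate_point_from_closed_convex_cone[OF cl cone y(2)] by blast
  have c_nonneg: "0 \<le> c \<bullet> snd g" if "g \<in> T" for g
    using c(1) that by (auto simp: dual_cone_def inner_commute)
  have dual_iff: "(\<xi>, \<zeta>) \<in> dual_cone T \<longleftrightarrow> (\<forall>g\<in>G. 0 \<le> (\<xi>, \<zeta>) \<bullet> g)" for \<zeta>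
    unfolding G(2) dual_cone_convex_cone_hull by (simp add: dual_cone_def inner_commute)
  have GT: "G \<subseteq> T" by (simp add: G hull_subset)
  \<comment> \<open>Only the generators in P limit the multiple of c that may be subtracted.
    If there were none, - c would be nonnegative on the image as well.\<close>
  define P where "P = {g \<in> G. c \<bullet> snd g > 0}"
  have "P \<noteq> {}"
  proof
    assume "P = {}"
    then have "(0, - c) \<in> dual_cone G"
      using c_nonneg GT by (force simp: P_def dual_cone_def inner_prod_def inner_commute not_less)
    then have "(0, - c) \<in> dual_cone T"
      by (simp add: G dual_cone_convex_cone_hull)
    then have "0 \<le> (- c) \<bullet> y"
      using y(1) by (force simp: dual_cone_def inner_prod_def inner_commute)
    with c(2) show False by simp
  qed
  \<comment> \<open>The ratio test of the simplex method: the smallest ratio over P is the largest admissible multiple.\<close>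
  define r where "r g = ((\<xi>, \<eta>) \<bullet> g) / (c \<bullet> snd g)" for g
  have "finite P" using G(1) by (simp add: P_def)
  then have "Min (r ` P) \<in> r ` P" using \<open>P \<noteq> {}\<close> by simp
  then obtain g where "g \<in> P" "r g = Min (r ` P)" by (metis imageE)
  then have g: "g \<in> P" "\<And>h. h \<in> P \<Longrightarrow> r g \<le> r h"
    using \<open>finite P\<close> by simp_all
  define \<eta>' where "\<eta>' = \<eta> - r g *\<^sub>R c"
  have eq: "(\<xi>, \<eta>') \<bullet> h = (\<xi>, \<eta>) \<bullet> h - r g * (c \<bullet> snd h)" for h
    by (simp add: \<eta>'_def inner_prod_def inner_diff_left)
  have gT: "g \<in> T" and cg: "c \<bullet> snd g > 0" using g(1) GT by (auto simp: P_def)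
  have "0 \<le> (\<xi>, \<eta>') \<bullet> h" if h: "h \<in> G" for h
  proof (cases "h \<in> P")
    case True
    then show ?thesis using g(2)[OF True] unfolding eq
      by (simp add: r_def[of h] P_def field_simps)
  next
    case False
    then have "c \<bullet> snd h = 0" using h c_nonneg[of h] GT by (auto simp: P_def)
    then show ?thesis using dual h unfolding eq by (auto simp: dual_iff)
  qed
  then have "(\<xi>, \<eta>') \<in> dual_cone T" by (simp add: dual_iff)
  moreover have "(\<xi>, \<eta>') \<bullet> g = 0" using cg unfolding eq by (simp add: r_def)
  moreover have "- g \<notin> T" using c_nonneg[of "- g"] cg by auto
  ultimately show thesis using that gT by blast
qed

text \<open>
  Among the finitely many tangent cones containing the given one and admitting a nonnegative
  functional with first component \<open>\<xi>\<close>, a maximal one is relatively surjective. Otherwise the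
  functional could be tilted until it vanishes on some \<open>g\<close> in the cone with \<open>- g\<close> outside it;
  moving the base point a little along \<open>g\<close> keeps the tilted functional nonnegative and adds
  \<open>- g\<close> to the tangent cone, contradicting maximality.
\<close>

lemma relatively_surjective_tangent_cone_with_functional:
  fixes K :: "('a::euclidean_space \<times> 'b::euclidean_space) set"
  assumes K: "polyhedral_convex_cone K" and p: "p \<in> K"
    and dual: "(\<xi>, \<eta>) \<in> dual_cone (tangent_cone K p)"
  obtains T \<eta>' where "T \<in> tangent_cones K" "relatively_surjective (sv_of T)"
    "tangent_cone K p \<subseteq> T" "(\<xi>, \<eta>') \<in> dual_cone T"
proof -
  have "convex K" using K by (simp add: polyhedral_convex_cone_def convex_cone_def)
  define \<T> where "\<T> = {T \<in> tangent_cones K. \<exists>\<eta>. (\<xi>, \<eta>) \<in> dual_cone T}"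
  have "finite \<T>" by (simp add: \<T>_def finite_tangent_cones[OF K])
  moreover have "tangent_cone K p \<in> \<T>"
    using p dual by (auto simp: \<T>_def tangent_cones_def)
  ultimately obtain T where T: "T \<in> \<T>" "tangent_cone K p \<subseteq> T"
    and maximal: "\<And>S. S \<in> \<T> \<Longrightarrow> T \<subseteq> S \<Longrightarrow> T = S"
    by (metis finite_has_maximal2)
  from T(1) obtain q \<zeta> where q: "q \<in> K" "T = tangent_cone K q" and \<zeta>: "(\<xi>, \<zeta>) \<in> dual_cone T"
    by (auto simp: \<T>_def tangent_cones_def)
  have "subspace (snd ` T)"
  proof (rule ccontr)
    assume "\<not> subspace (snd ` T)"
    moreover have "polyhedral_convex_cone T"
      by (simp add: q polyhedral_tangent_cone[OF K])
    ultimately obtain g \<zeta>' where g: "g \<in> T" "- g \<notin> T"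
      and \<zeta>': "(\<xi>, \<zeta>') \<in> dual_cone T" "(\<xi>, \<zeta>') \<bullet> g = 0"
      using tilt_functional_to_new_face[OF _ \<zeta>] by blast
    obtain t where t: "t > 0" "q + t *\<^sub>R g \<in> K"
      using g(1) by (auto simp: q tangent_cone_def)
    define q' where "q' = q + (t/2) *\<^sub>R g"
    define S where "S = tangent_cone K q'"
    have "(1/2) *\<^sub>R q + (1/2) *\<^sub>R (q + t *\<^sub>R g) \<in> K"
      using \<open>convex K\<close> q(1) t(2) by (intro convexD) auto
    moreover have "(1/2) *\<^sub>R q + (1/2) *\<^sub>R (q + t *\<^sub>R g) = q'"
      by (simp add: q'_def algebra_simps flip: scaleR_2)
    ultimately have q'K: "q' \<in> K" by simp
    have "T \<subseteq> S"
      unfolding S_def q'_def q(2) using t(2)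
      by (intro tangent_cone_mono_along_segment \<open>convex K\<close> q(1)) simp
    \<comment> \<open>A tangent move at q' is a tangent move at q up to a multiple of g, where the functional vanishes.\<close>
    have "(\<xi>, \<zeta>') \<in> dual_cone S"
    proof (rule dual_coneI)
      fix w assume "w \<in> S"
      then obtain s where s: "s > 0" "q' + s *\<^sub>R w \<in> K"
        by (auto simp: S_def tangent_cone_def)
      have "(q' + s *\<^sub>R w) - q \<in> T"
        unfolding q(2) by (rule diff_in_tangent_cone[OF s(2)])
      from dual_coneD[OF \<zeta>'(1) this] have "0 \<le> ((t/2) *\<^sub>R g + s *\<^sub>R w) \<bullet> (\<xi>, \<zeta>')"
        by (simp add: q'_def)
      then have "0 \<le> s * (w \<bullet> (\<xi>, \<zeta>'))"
        using \<zeta>'(2) by (simp only: inner_add_left inner_scaleR_left inner_commute[of g])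
      with s(1) show "0 \<le> w \<bullet> (\<xi>, \<zeta>')" by (simp add: zero_le_mult_iff)
    qed
    then have "S \<in> \<T>" using q'K by (auto simp: \<T>_def S_def tangent_cones_def)
    with \<open>T \<subseteq> S\<close> have "T = S" using maximal by blast
    moreover have "- g \<in> S"
      unfolding S_def tangent_cone_def q'_def using t(1) q(1) by (auto intro!: exI[of _ "t/2"])
    ultimately show False using g(2) by blast
  qed
  then have "relatively_surjective (sv_of T)"
    by (simp add: relatively_surjective_def sv_Im_eq_snd_image)
  then show thesis using that T \<zeta> by (auto simp: \<T>_def)
qed

section \<open>Sublinear functions and arbitrary norms\<close>

text \<open>
  Sublinearity bounds \<open>f\<close> by its values at plus and minus an orthonormal basis. Stated on a
  subspace because it is applied both to a norm on the whole space and to the least norm of a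
  preimage, which is finite only on the image of the set-valued mapping.
\<close>

lemma sublinear_bounded_on_subspace:
  fixes f :: "'a::euclidean_space \<Rightarrow> real"
  assumes V: "subspace V"
    and add: "\<And>x y. x \<in> V \<Longrightarrow> y \<in> V \<Longrightarrow> f (x + y) \<le> f x + f y"
    and scale: "\<And>c x. c \<ge> 0 \<Longrightarrow> x \<in> V \<Longrightarrow> f (c *\<^sub>R x) \<le> c * f x"
  obtains C where "C > 0" "\<And>x. x \<in> V \<Longrightarrow> f x \<le> C * norm x"
proof -
  obtain B where B: "B \<subseteq> V" "pairwise orthogonal B" "\<And>x. x \<in> B \<Longrightarrow> norm x = 1"
    "independent B" "span B = V"
    using orthonormal_basis_subspace[OF V] by metis
  have "finite B" using B(4) by (rule independent_imp_finite)
  define m where "m b = \<bar>f b\<bar> + \<bar>f (- b)\<bar>" for b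
  have sum_le: "f (\<Sum>b\<in>S. g b) \<le> (\<Sum>b\<in>S. f (g b))"
    if "finite S" "\<And>b. b \<in> S \<Longrightarrow> g b \<in> V" for S :: "'a set" and g
    using that
  proof (induction S rule: finite_induct)
    case empty
    show ?case using scale[of 0 0] subspace_0[OF V] by simp
  next
    case (insert b S)
    have "f (g b + (\<Sum>b\<in>S. g b)) \<le> f (g b) + f (\<Sum>b\<in>S. g b)"
      using insert.prems by (intro add subspace_sum V) auto
    then show ?case using insert by force
  qed
  have bound: "f x \<le> (\<Sum>b\<in>B. m b) * norm x" if x: "x \<in> V" for x
  proof -
    have term_le: "f ((x \<bullet> b) *\<^sub>R b) \<le> norm x * m b" if b: "b \<in> B" for b
    proof -
      have bV: "b \<in> V" "- b \<in> V" using b B(1) V subspace_neg by auto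
      have "\<bar>x \<bullet> b\<bar> \<le> norm x"
        using Cauchy_Schwarz_ineq2[of x b] B(3)[OF b] by simp
      moreover have "f ((x \<bullet> b) *\<^sub>R b) \<le> \<bar>x \<bullet> b\<bar> * m b"
      proof (cases "x \<bullet> b \<ge> 0")
        case True
        have "f ((x \<bullet> b) *\<^sub>R b) \<le> (x \<bullet> b) * f b" by (rule scale[OF True bV(1)])
        also have "\<dots> \<le> (x \<bullet> b) * m b" using True by (intro mult_left_mono) (auto simp: m_def)
        finally show ?thesis using True by simp
      next
        case False
        have "f ((- (x \<bullet> b)) *\<^sub>R (- b)) \<le> (- (x \<bullet> b)) * f (- b)"
          using False by (intro scale bV(2)) simp
        also have "\<dots> \<le> (- (x \<bullet> b)) * m b"
          using False by (intro mult_left_mono) (auto simp: m_def)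
        finally show ?thesis using False by simp
      qed
      ultimately show ?thesis
        using mult_right_mono[of "\<bar>x \<bullet> b\<bar>" "norm x" "m b"] by (simp add: m_def)
    qed
    have "(\<Sum>b\<in>B. (x \<bullet> b) *\<^sub>R b) = x"
      using x B(5) by (intro orthonormal_basis_expand B(2,3) \<open>finite B\<close>) auto
    then have "f x = f (\<Sum>b\<in>B. (x \<bullet> b) *\<^sub>R b)" by simp
    also have "\<dots> \<le> (\<Sum>b\<in>B. f ((x \<bullet> b) *\<^sub>R b))"
      using B(1) V by (intro sum_le \<open>finite B\<close>) (auto intro: subspace_scale)
    also have "\<dots> \<le> (\<Sum>b\<in>B. norm x * m b)" by (intro sum_mono term_le)
    finally show ?thesis by (simp add: sum_distrib_left mult.commute)
  qed
  show thesis
  proof (rule that[of "(\<Sum>b\<in>B. m b) + 1"])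
    have "0 \<le> (\<Sum>b\<in>B. m b)" by (intro sum_nonneg) (simp add: m_def)
    then show "0 < (\<Sum>b\<in>B. m b) + 1" by simp
    fix x assume "x \<in> V"
    from bound[OF this] show "f x \<le> ((\<Sum>b\<in>B. m b) + 1) * norm x"
      using norm_ge_zero[of x] by (simp only: distrib_right mult_1)
  qed
qed

lemma sublinear_continuous_on_subspace:
  fixes f :: "'a::euclidean_space \<Rightarrow> real"
  assumes V: "subspace V"
    and add: "\<And>x y. x \<in> V \<Longrightarrow> y \<in> V \<Longrightarrow> f (x + y) \<le> f x + f y"
    and scale: "\<And>c x. c \<ge> 0 \<Longrightarrow> x \<in> V \<Longrightarrow> f (c *\<^sub>R x) \<le> c * f x"
  shows "continuous_on V f"
proof -
  obtain C where C: "C > 0" "\<And>x. x \<in> V \<Longrightarrow> f x \<le> C * norm x"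
    using sublinear_bounded_on_subspace[of V f] assms by blast
  have le: "f x - f y \<le> C * norm (x - y)" if "x \<in> V" "y \<in> V" for x y
    using add[of y "x - y"] C(2)[of "x - y"] that subspace_diff[OF V] by fastforce
  have "C-lipschitz_on V f"
  proof (rule lipschitz_onI)
    fix x y assume "x \<in> V" "y \<in> V"
    then show "dist (f x) (f y) \<le> C * dist x y"
      using le[of x y] le[of y x] by (simp add: dist_norm norm_minus_commute abs_le_iff)
  qed (use C(1) in simp)
  then show ?thesis by (rule lipschitz_on_continuous_on)
qed

lemma is_norm_nonneg: "is_norm N \<Longrightarrow> 0 \<le> N x"
  and is_norm_eq_0_iff: "is_norm N \<Longrightarrow> N x = 0 \<longleftrightarrow> x = 0"
  and is_norm_scaleR: "is_norm N \<Longrightarrow> N (c *\<^sub>R x) = \<bar>c\<bar> * N x"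
  and is_norm_triangle: "is_norm N \<Longrightarrow> N (x + y) \<le> N x + N y"
  by (auto simp: is_norm_def)

lemma is_norm_minus_commute: "is_norm N \<Longrightarrow> N (x - y) = N (y - x)"
  using is_norm_scaleR[of N "-1" "x - y"] by simp

lemma is_norm_pos: "is_norm N \<Longrightarrow> x \<noteq> 0 \<Longrightarrow> 0 < N x"
  using is_norm_nonneg[of N x] is_norm_eq_0_iff[of N x] by simp

lemma is_norm_continuous_on:
  fixes N :: "'a::euclidean_space \<Rightarrow> real"
  assumes "is_norm N"
  shows "continuous_on S N"
  by (rule continuous_on_subset[OF sublinear_continuous_on_subspace[of UNIV N] subset_UNIV])
     (simp_all add: assms is_norm_triangle is_norm_scaleR)

text \<open>
  One half of the equivalence of norms; the constant is the minimum of \<open>N\<close> on the unit sphere.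
\<close>

lemma is_norm_coercive:
  fixes N :: "'a::euclidean_space \<Rightarrow> real"
  assumes N: "is_norm N"
  obtains c where "c > 0" "\<And>x. c * norm x \<le> N x"
proof -
  have "sphere 0 1 \<noteq> ({} :: 'a set)" by simp
  then obtain e :: 'a where e: "norm e = 1" "\<And>x. norm x = 1 \<Longrightarrow> N e \<le> N x"
    using continuous_attains_inf[OF compact_sphere _ is_norm_continuous_on[OF N], of 0 1]
    by (force simp: dist_norm)
  have "N e * norm x \<le> N x" for x
  proof (cases "x = 0")
    case False
    have "N x = N (norm x *\<^sub>R (x /\<^sub>R norm x))" using False by simp
    also have "\<dots> = norm x * N (x /\<^sub>R norm x)" using is_norm_scaleR[OF N] by (metis abs_norm_cancel)
    finally show ?thesis
      using e(2)[of "x /\<^sub>R norm x"] False by (simp add: mult.commute mult_left_mono)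
  qed (simp add: is_norm_nonneg[OF N])
  moreover have "N e > 0" using e(1) by (intro is_norm_pos[OF N]) auto
  ultimately show thesis using that by blast
qed

lemma is_norm_bounded:
  fixes N :: "'a::euclidean_space \<Rightarrow> real"
  assumes "is_norm N"
  shows "bounded {x. N (x - u) \<le> r}"
proof -
  obtain c where c: "c > 0" "\<And>x. c * norm x \<le> N x" by (rule is_norm_coercive[OF assms]) blast
  have "dist u x \<le> r / c" if "N (x - u) \<le> r" for x
    using c(2)[of "x - u"] that c(1) by (simp add: dist_norm norm_minus_commute field_simps)
  then show ?thesis by (auto simp: bounded_def)
qed

lemma is_norm_attains_distance:
  fixes N :: "'a::euclidean_space \<Rightarrow> real"
  assumes N: "is_norm N" and S: "closed S" "S \<noteq> {}"
  obtains x where "x \<in> S" "\<And>y. y \<in> S \<Longrightarrow> N (x - u) \<le> N (y - u)"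
proof -
  obtain s where s: "s \<in> S" using S(2) by blast
  define C where "C = S \<inter> {x. N (x - u) \<le> N (s - u)}"
  have cont: "continuous_on A (\<lambda>x. N (x - u))" for A
    by (intro continuous_on_compose2[OF is_norm_continuous_on[OF N, of UNIV]] continuous_intros) auto
  have "closed {x. N (x - u) \<le> N (s - u)}"
    by (intro closed_Collect_le cont continuous_intros)
  then have "compact C"
    unfolding compact_eq_bounded_closed C_def
    using S(1) is_norm_bounded[OF N] by (auto intro: bounded_subset)
  moreover have "s \<in> C" using s by (simp add: C_def)
  ultimately obtain x where "x \<in> C" "\<And>y. y \<in> C \<Longrightarrow> N (x - u) \<le> N (y - u)"
    using continuous_attains_inf[OF _ _ cont, of C] by blast
  then show thesis using that[of x] unfolding C_def by (force simp: not_le)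
qed

lemma INF_ereal_eq_min:
  assumes "x \<in> S" "\<And>y. y \<in> S \<Longrightarrow> f x \<le> f y"
  shows "(INF y\<in>S. ereal (f y)) = ereal (f x)"
  using assms by (intro antisym INF_greatest INF_lower2[of x]) auto

lemma SUP_ereal_eq_max:
  assumes "x \<in> S" "\<And>y. y \<in> S \<Longrightarrow> f y \<le> f x"
  shows "(SUP y\<in>S. ereal (f y)) = ereal (f x)"
  using assms by (intro antisym SUP_least SUP_upper2[of x]) auto

lemma mem_sv_inv_sv_of [simp]: "x \<in> sv_inv (sv_of T) y \<longleftrightarrow> (x, y) \<in> T"
  by (simp add: sv_inv_def sv_of_def)

text \<open>
  On a cone that is relatively surjective, the least norm of a preimage of \<open>y\<close> is a finite
  sublinear function of \<open>y\<close> on a subspace, thus continuous, and it attains its maximum on the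
  compact unit ball of that subspace. Relative surjectivity enters by making the domain of that
  function a subspace.
\<close>

lemma inv_norm_on_attained:
  fixes T :: "('a::euclidean_space \<times> 'b::euclidean_space) set"
  assumes N: "is_norm N" and M: "is_norm M" and L: "subspace L"
    and T: "polyhedral_convex_cone T" and rs: "relatively_surjective (sv_of T)"
  obtains y r where "y \<in> snd ` T \<inter> L" "M y \<le> 1" "inv_norm_on N M (sv_of T) L = ereal r" "0 \<le> r"
    "\<And>x. (x, y) \<in> T \<Longrightarrow> r \<le> N x"
proof -
  define V where "V = snd ` T \<inter> L"
  have V: "subspace V"
    using rs L by (simp add: V_def relatively_surjective_def sv_Im_eq_snd_image subspace_inter)
  have cone: "convex_cone T" using T by (simp add: polyhedral_convex_cone_def)
  have "\<exists>x. (x, y) \<in> T \<and> (\<forall>z. (z, y) \<in> T \<longrightarrow> N x \<le> N z)" if y: "y \<in> V" for y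
  proof -
    have "closed ((\<lambda>x. (x, y)) -` T)"
      by (intro closed_vimage closed_polyhedral_convex_cone[OF T] continuous_intros)
    moreover have "(\<lambda>x. (x, y)) -` T \<noteq> {}" using y by (force simp: V_def)
    ultimately show ?thesis
      using is_norm_attains_distance[OF N, of "(\<lambda>x. (x, y)) -` T" 0] by auto
  qed
  \<comment> \<open>s selects a preimage of least norm.\<close>
  then obtain s where s: "\<And>y. y \<in> V \<Longrightarrow> (s y, y) \<in> T"
    and s_min: "\<And>x y. y \<in> V \<Longrightarrow> (x, y) \<in> T \<Longrightarrow> N (s y) \<le> N x"
    by metis
  have "continuous_on V (\<lambda>y. N (s y))"
  proof (rule sublinear_continuous_on_subspace[OF V])
    fix x y assume xy: "x \<in> V" "y \<in> V"
    have "(s x + s y, x + y) \<in> T"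
      using convex_cone_add[OF cone s[OF xy(1)] s[OF xy(2)]] by simp
    then show "N (s (x + y)) \<le> N (s x) + N (s y)"
      using s_min subspace_add[OF V xy] is_norm_triangle[OF N] order_trans by meson
  next
    fix c :: real and x assume c: "c \<ge> 0" and x: "x \<in> V"
    have "(c *\<^sub>R s x, c *\<^sub>R x) \<in> T"
      using convex_cone_scaleR[OF cone c s[OF x]] by simp
    from s_min[OF subspace_scale[OF V x] this] show "N (s (c *\<^sub>R x)) \<le> c * N (s x)"
      using c by (simp add: is_norm_scaleR[OF N])
  qed
  moreover have "compact (V \<inter> {y. M y \<le> 1})"
    unfolding compact_eq_bounded_closed
    using is_norm_bounded[OF M, of 0 1] closed_subspace[OF V]
    by (auto intro!: bounded_Int closed_Collect_le is_norm_continuous_on M continuous_intros)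
  moreover have "0 \<in> V \<inter> {y. M y \<le> 1}"
    using subspace_0[OF V] is_norm_eq_0_iff[OF M, of 0] by simp
  ultimately obtain y where y: "y \<in> V" "M y \<le> 1"
    and max: "\<And>z. z \<in> V \<Longrightarrow> M z \<le> 1 \<Longrightarrow> N (s z) \<le> N (s y)"
    using continuous_attains_sup[of "V \<inter> {y. M y \<le> 1}" "\<lambda>y. N (s y)"]
    by (force intro: continuous_on_subset)
  have "(INF x\<in>sv_inv (sv_of T) z. ereal (N x)) = ereal (N (s z))" if "z \<in> V" for z
    using s s_min that by (intro INF_ereal_eq_min) auto
  then have "inv_norm_on N M (sv_of T) L
      = (SUP z\<in>{z \<in> sv_Im (sv_of T) \<inter> L. M z \<le> 1}. ereal (N (s z)))"
    unfolding inv_norm_on_def by (intro SUP_cong) (auto simp: V_def sv_Im_eq_snd_image)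
  also have "\<dots> = ereal (N (s y))"
    using y max by (intro SUP_ereal_eq_max) (auto simp: V_def sv_Im_eq_snd_image)
  finally show thesis
    using that[of y "N (s y)"] y s_min is_norm_nonneg[OF N] by (auto simp: V_def)
qed

section \<open>The Hoffman constant is attained\<close>

text \<open>
  The zero functional is nonnegative on the tangent cone at the origin, so it leads to a
  relatively surjective tangent cone. Without this, the Hoffman constant could be the supremum
  \<open>-\<infinity>\<close> of the empty set.
\<close>

lemma rs_tangent_cones_nonempty:
  fixes \<Phi> :: "'a::euclidean_space \<Rightarrow> 'b::euclidean_space set"
  assumes "polyhedral_sublinear \<Phi>"
  shows "rs_tangent_cones \<Phi> \<noteq> {}"
proof -
  have K: "polyhedral_convex_cone (sv_graph \<Phi>)"
    using assms by (simp add: polyhedral_sublinear_def)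
  then have "0 \<in> sv_graph \<Phi>"
    by (simp add: polyhedral_convex_cone_def convex_cone_contains_0)
  moreover have "(0, 0) \<in> dual_cone (tangent_cone (sv_graph \<Phi>) 0)"
    by (simp add: dual_cone_def inner_prod_def)
  ultimately obtain T where "T \<in> tangent_cones (sv_graph \<Phi>)" "relatively_surjective (sv_of T)"
    using relatively_surjective_tangent_cone_with_functional[OF K] by metis
  then show ?thesis by (auto simp: rs_tangent_cones_def)
qed

lemma hoffman_const_attained:
  fixes \<Phi> :: "'a::euclidean_space \<Rightarrow> 'b::euclidean_space set"
  assumes N: "is_norm N" and M: "is_norm M" and L: "subspace L" and \<Phi>: "polyhedral_sublinear \<Phi>"
  obtains T y r where "T \<in> rs_tangent_cones \<Phi>" "y \<in> snd ` T \<inter> L" "M y \<le> 1"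
    "hoffman_const N M \<Phi> L = ereal r" "0 \<le> r" "\<And>x. (x, y) \<in> T \<Longrightarrow> r \<le> N x"
proof -
  have K: "polyhedral_convex_cone (sv_graph \<Phi>)"
    using \<Phi> by (simp add: polyhedral_sublinear_def)
  have fin: "finite (rs_tangent_cones \<Phi>)"
    using finite_tangent_cones[OF K] by (simp add: rs_tangent_cones_def)
  have "hoffman_const N M \<Phi> L \<in> (\<lambda>T. inv_norm_on N M (sv_of T) L) ` rs_tangent_cones \<Phi>"
    unfolding hoffman_const_def using fin rs_tangent_cones_nonempty[OF \<Phi>]
    by (simp add: Max_Sup[symmetric] Max_in)
  then obtain T where T: "T \<in> rs_tangent_cones \<Phi>"
    and eq: "hoffman_const N M \<Phi> L = inv_norm_on N M (sv_of T) L" by blast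
  from T have "polyhedral_convex_cone T" "relatively_surjective (sv_of T)"
    using polyhedral_tangent_cone[OF K] by (auto simp: rs_tangent_cones_def tangent_cones_def)
  then obtain y r where "y \<in> snd ` T \<inter> L" "M y \<le> 1"
      "inv_norm_on N M (sv_of T) L = ereal r" "0 \<le> r" "\<And>x. (x, y) \<in> T \<Longrightarrow> r \<le> N x"
    using inv_norm_on_attained[OF N M L] by metis
  then show thesis using that[of T y r] T eq by simp
qed

section \<open>The error bound and its tightness\<close>

text \<open>
  The optimality condition for a least-norm point \<open>w\<close> of a convex set: a hyperplane separating
  the set from the open ball of radius \<open>N w\<close>. The last inequality says, without introducing a
  dual norm, that \<open>\<xi>\<close> divided by its value at \<open>w\<close> has dual norm at most \<open>1 / N w\<close>.
\<close>

lemma norm_minimal_in_convex_functional: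
  fixes N :: "'a::euclidean_space \<Rightarrow> real"
  assumes N: "is_norm N" and S: "convex S" "w \<in> S" "N w > 0"
    and min: "\<And>z. z \<in> S \<Longrightarrow> N w \<le> N z"
  obtains \<xi> where "\<xi> \<bullet> w > 0" "\<And>z. z \<in> S \<Longrightarrow> \<xi> \<bullet> w \<le> \<xi> \<bullet> z"
    "\<And>z. (\<xi> \<bullet> z) * N w \<le> (\<xi> \<bullet> w) * N z"
proof -
  define B where "B = {z. N z < N w}"
  have "convex B"
  proof (rule convexI)
    fix x y and u v :: real
    assume xy: "x \<in> B" "y \<in> B" and uv: "0 \<le> u" "0 \<le> v" "u + v = 1"
    have "N (u *\<^sub>R x + v *\<^sub>R y) \<le> u * N x + v * N y"
      using is_norm_triangle[OF N, of "u *\<^sub>R x" "v *\<^sub>R y"] uv by (simp add: is_norm_scaleR[OF N])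
    also have "\<dots> < N w"
      using xy uv by (intro convex_bound_lt) (auto simp: B_def)
    finally show "u *\<^sub>R x + v *\<^sub>R y \<in> B" by (simp add: B_def)
  qed
  moreover have "0 \<in> B" using S(3) is_norm_eq_0_iff[OF N, of 0] by (simp add: B_def)
  moreover have "B \<inter> S = {}" using min by (force simp: B_def)
  ultimately obtain \<xi> \<beta> where \<xi>: "\<xi> \<noteq> 0" "\<And>z. z \<in> B \<Longrightarrow> \<xi> \<bullet> z \<le> \<beta>" "\<And>z. z \<in> S \<Longrightarrow> \<beta> \<le> \<xi> \<bullet> z"
    using separating_hyperplane_sets[of B S] S by blast
  \<comment> \<open>Rescale z to norm just below N w, use the separation there and let the norm tend to N w.\<close>
  have \<beta>: "(\<xi> \<bullet> z) * N w \<le> \<beta> * N z" for z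
  proof (cases "z = 0")
    case False
    then have pos: "N z > 0" by (rule is_norm_pos[OF N])
    have "(\<xi> \<bullet> z) * N w / N z \<le> \<beta>"
    proof (rule field_le_mult_one_interval)
      fix t :: real assume t: "0 < t" "t < 1"
      have "t * (N w / N z) * N z < N w" using t pos S(3) by simp
      then have "(t * (N w / N z)) *\<^sub>R z \<in> B"
        using t pos S(3) by (simp add: B_def is_norm_scaleR[OF N] abs_mult)
      from \<xi>(2)[OF this] show "t * ((\<xi> \<bullet> z) * N w / N z) \<le> \<beta>" by (simp add: mult_ac)
    qed
    then show ?thesis using pos by (simp add: field_simps)
  qed (use is_norm_eq_0_iff[OF N, of 0] in simp)
  have eq: "\<xi> \<bullet> w = \<beta>"
    using \<beta>[of w] \<xi>(3)[OF S(2)] S(3) by simp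
  have "0 < (\<xi> \<bullet> \<xi>) * N w" using \<xi>(1) S(3) by simp
  then have "0 < \<beta> * N \<xi>" using \<beta>[of \<xi>] by linarith
  then have "\<beta> > 0" using is_norm_nonneg[OF N, of \<xi>] by (simp add: zero_less_mult_iff)
  then show thesis using that[of \<xi>] \<beta> \<xi>(3) eq by simp
qed

text \<open>
  The heart of the error bound. Let \<open>x\<close> be a point of the inverse image of \<open>b\<close> nearest to \<open>u\<close>. The
  optimality condition gives a functional \<open>\<xi>\<close> that is nonnegative on the slice of the tangent
  cone at \<open>(x, b)\<close> over \<open>0\<close>; it extends to a functional \<open>(\<xi>, \<eta>)\<close> on the whole tangent cone, and
  then on a larger, relatively surjective one, \<open>T\<close>. As \<open>(u - x, y - b)\<close> lies in \<open>T\<close>, evaluating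
  the functional there and at any \<open>(z, b - y)\<close> in \<open>T\<close> and adding shows that \<open>\<xi>\<close> is at least as
  large at \<open>z\<close> as at \<open>x - u\<close>, which forces \<open>z\<close> to have at least the norm of \<open>x - u\<close>.
\<close>

lemma rs_tangent_cone_with_long_preimages:
  fixes \<Phi> :: "'a::euclidean_space \<Rightarrow> 'b::euclidean_space set"
  assumes N: "is_norm N" and \<Phi>: "polyhedral_sublinear \<Phi>" and y: "y \<in> \<Phi> u" and b: "b \<in> sv_Im \<Phi>"
  obtains x T where "b \<in> \<Phi> x" "T \<in> rs_tangent_cones \<Phi>" "b - y \<in> snd ` T"
    "\<And>z. (z, b - y) \<in> T \<Longrightarrow> N (x - u) \<le> N z"
proof -
  define K where "K = sv_graph \<Phi>"
  have K: "polyhedral_convex_cone K"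
    using \<Phi> by (simp add: polyhedral_sublinear_def K_def)
  then have conv: "convex K" by (simp add: polyhedral_convex_cone_def convex_cone_def)
  have mem_K: "(x, y) \<in> K \<longleftrightarrow> y \<in> \<Phi> x" for x y by (simp add: K_def sv_graph_def)
  \<comment> \<open>The displacements from u to points of the inverse image of b.\<close>
  define S where "S = {w. (u + w, b) \<in> K}"
  have "S = (\<lambda>w. (u + w, b)) -` K" by (auto simp: S_def)
  moreover have "closed ((\<lambda>w. (u + w, b)) -` K)"
    by (intro closed_vimage closed_polyhedral_convex_cone[OF K] continuous_intros)
  ultimately have "closed S" by simp
  have "convex S"
  proof (rule convexI)
    fix x y and s t :: real
    assume "x \<in> S" "y \<in> S" and st: "0 \<le> s" "0 \<le> t" "s + t = 1"
    then have "s *\<^sub>R (u + x, b) + t *\<^sub>R (u + y, b) \<in> K"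
      using conv by (intro convexD) (auto simp: S_def)
    moreover have "s *\<^sub>R (u + x, b) + t *\<^sub>R (u + y, b)
        = ((s + t) *\<^sub>R u + (s *\<^sub>R x + t *\<^sub>R y), (s + t) *\<^sub>R b)"
      by (simp add: algebra_simps)
    ultimately show "s *\<^sub>R x + t *\<^sub>R y \<in> S" using st by (simp add: S_def)
  qed
  obtain x0 where "(x0, b) \<in> K" using b by (auto simp: sv_Im_def K_def)
  then have "x0 - u \<in> S" by (simp add: S_def)
  then obtain w where w: "w \<in> S" and w_min: "\<And>z. z \<in> S \<Longrightarrow> N w \<le> N z"
    using is_norm_attains_distance[OF N \<open>closed S\<close>, of 0] by auto
  define p where "p = (u + w, b)"
  have pK: "p \<in> K" using w by (simp add: S_def p_def)
  have reverse: "(- w, - (b - y)) \<in> tangent_cone K p"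
    using diff_in_tangent_cone[of "(u, y)" K p] y by (simp add: p_def mem_K)
  obtain T where T: "T \<in> rs_tangent_cones \<Phi>" "tangent_cone K p \<subseteq> T"
    "\<And>z. (z, b - y) \<in> T \<Longrightarrow> N w \<le> N z"
  \<comment> \<open>For w = 0 the bound on preimages is trivial, and the zero functional yields T.\<close>
  proof (cases "w = 0")
    case True
    have "(0, 0) \<in> dual_cone (tangent_cone K p)"
      by (auto simp: dual_cone_def inner_prod_def)
    then show thesis
      using relatively_surjective_tangent_cone_with_functional[OF K pK, of 0 0] that True
        is_norm_nonneg[OF N] is_norm_eq_0_iff[OF N, of 0]
      by (metis (no_types, lifting) K_def mem_Collect_eq rs_tangent_cones_def)
  next
    case False
    then have "N w > 0" by (rule is_norm_pos[OF N])
    then obtain \<xi> where \<xi>: "\<xi> \<bullet> w > 0" "\<And>z. z \<in> S \<Longrightarrow> \<xi> \<bullet> w \<le> \<xi> \<bullet> z"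
      "\<And>z. (\<xi> \<bullet> z) * N w \<le> (\<xi> \<bullet> w) * N z"
      using norm_minimal_in_convex_functional[OF N \<open>convex S\<close> w _ w_min] by blast
    have "0 \<le> \<xi> \<bullet> z" if z: "(z, 0) \<in> tangent_cone K p" for z
    proof -
      obtain t where t: "t > 0" "p + t *\<^sub>R (z, 0) \<in> K"
        using z by (auto simp: tangent_cone_def)
      then have "w + t *\<^sub>R z \<in> S" by (simp add: S_def p_def add.assoc)
      from \<xi>(2)[OF this] show ?thesis
        using t(1) by (simp add: inner_add_right zero_le_mult_iff)
    qed
    then obtain \<eta> where "(\<xi>, \<eta>) \<in> dual_cone (tangent_cone K p)"
      using extend_nonneg_functional_from_slice[OF polyhedral_tangent_cone[OF K pK]] by blast
    then obtain T \<eta>' where T: "T \<in> tangent_cones K" "relatively_surjective (sv_of T)"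
      "tangent_cone K p \<subseteq> T" and dual: "(\<xi>, \<eta>') \<in> dual_cone T"
      using relatively_surjective_tangent_cone_with_functional[OF K pK] by blast
    have "N w \<le> N z" if z: "(z, b - y) \<in> T" for z
    proof -
      have "0 \<le> (z, b - y) \<bullet> (\<xi>, \<eta>')" "0 \<le> (- w, - (b - y)) \<bullet> (\<xi>, \<eta>')"
        using dual_coneD[OF dual] z reverse T(3) by blast+
      then have "\<xi> \<bullet> w \<le> \<xi> \<bullet> z"
        by (simp add: inner_prod_def inner_commute[of \<xi>] inner_diff_left)
      then have "(\<xi> \<bullet> w) * N w \<le> (\<xi> \<bullet> z) * N w"
        using \<open>N w > 0\<close> by simp
      also have "\<dots> \<le> (\<xi> \<bullet> w) * N z" by (rule \<xi>(3))
      finally show ?thesis using \<xi>(1) by simp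
    qed
    then show thesis using that[of T] T by (simp add: rs_tangent_cones_def K_def)
  qed
  have "- (b - y) \<in> snd ` T" using reverse T(2) by force
  moreover have "subspace (snd ` T)"
    using T(1) by (simp add: rs_tangent_cones_def relatively_surjective_def sv_Im_eq_snd_image)
  ultimately have "b - y \<in> snd ` T" using subspace_neg[of "snd ` T" "- (b - y)"] by simp
  moreover have "b \<in> \<Phi> (u + w)" using pK by (simp add: p_def mem_K)
  ultimately show thesis using that[of "u + w" T] T by simp
qed

lemma preimage_norm_le_inv_norm_on:
  assumes N: "is_norm N" and M: "is_norm M" and L: "subspace L"
    and cone: "convex_cone T" and v: "v \<in> snd ` T \<inter> L" "v \<noteq> 0"
    and d: "\<And>z. (z, v) \<in> T \<Longrightarrow> d \<le> N z"
  shows "ereal (d / M v) \<le> inv_norm_on N M (sv_of T) L"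
proof -
  have pos: "M v > 0" by (rule is_norm_pos[OF M v(2)])
  define y where "y = (1 / M v) *\<^sub>R v"
  have "M y \<le> 1" using pos by (simp add: y_def is_norm_scaleR[OF M])
  obtain x where "(x, v) \<in> T" using v(1) by auto
  then have "((1 / M v) *\<^sub>R x, y) \<in> T"
    using convex_cone_scaleR[OF cone, of "1 / M v" "(x, v)"] pos by (simp add: y_def)
  then have "y \<in> sv_Im (sv_of T) \<inter> L"
    using v(1) L by (force simp: sv_Im_eq_snd_image y_def subspace_scale)
  have "ereal (d / M v) \<le> (INF x\<in>sv_inv (sv_of T) y. ereal (N x))"
  proof (rule INF_greatest)
    fix x assume "x \<in> sv_inv (sv_of T) y"
    then have "(M v *\<^sub>R x, v) \<in> T"
      using convex_cone_scaleR[OF cone, of "M v" "(x, y)"] pos by (simp add: y_def)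
    from d[OF this] show "ereal (d / M v) \<le> ereal (N x)"
      using pos by (simp add: is_norm_scaleR[OF N] field_simps)
  qed
  also have "\<dots> \<le> inv_norm_on N M (sv_of T) L"
    unfolding inv_norm_on_def using \<open>M y \<le> 1\<close> \<open>y \<in> _\<close> by (intro SUP_upper) simp
  finally show ?thesis .
qed

lemma dist_set_sv_inv_le:
  fixes \<Phi> :: "'a::euclidean_space \<Rightarrow> 'b::euclidean_space set"
  assumes N: "is_norm N" and M: "is_norm M" and L: "subspace L" and \<Phi>: "polyhedral_sublinear \<Phi>"
    and b: "b \<in> sv_Im \<Phi>" and finite_dist: "dist_along M L b (\<Phi> u) \<noteq> \<infinity>"
  shows "dist_set N u (sv_inv \<Phi> b) \<le> hoffman_const N M \<Phi> L * dist_along M L b (\<Phi> u)"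
proof -
  have K: "polyhedral_convex_cone (sv_graph \<Phi>)"
    using \<Phi> by (simp add: polyhedral_sublinear_def)
  define Y where "Y = {y \<in> \<Phi> u. b - y \<in> L}"
  have "Y = (\<lambda>y. (u, y)) -` sv_graph \<Phi> \<inter> (\<lambda>y. b - y) -` L"
    by (auto simp: Y_def sv_graph_def)
  moreover have "closed ((\<lambda>y. (u, y)) -` sv_graph \<Phi>)" "closed ((\<lambda>y. b - y) -` L)"
    by (intro closed_vimage closed_polyhedral_convex_cone[OF K] closed_subspace[OF L]
        continuous_intros)+
  ultimately have "closed Y" by auto
  moreover have "Y \<noteq> {}"
    using finite_dist unfolding dist_along_def Y_def[symmetric] by (auto simp: top_ereal_def)
  ultimately obtain y where y: "y \<in> Y" and y_min: "\<And>z. z \<in> Y \<Longrightarrow> M (y - b) \<le> M (z - b)"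
    using is_norm_attains_distance[OF M] by metis
  have dist: "dist_along M L b (\<Phi> u) = ereal (M (b - y))"
    unfolding dist_along_def Y_def[symmetric]
    using y y_min by (intro INF_ereal_eq_min) (auto simp: is_norm_minus_commute[OF M, of b])
  obtain r where r: "hoffman_const N M \<Phi> L = ereal r" "0 \<le> r"
    using hoffman_const_attained[OF N M L \<Phi>] by metis
  have "y \<in> \<Phi> u" "b - y \<in> L" using y by (auto simp: Y_def)
  obtain x T where x: "b \<in> \<Phi> x" and T: "T \<in> rs_tangent_cones \<Phi>" "b - y \<in> snd ` T"
    and long: "\<And>z. (z, b - y) \<in> T \<Longrightarrow> N (x - u) \<le> N z"
    using rs_tangent_cone_with_long_preimages[OF N \<Phi> \<open>y \<in> \<Phi> u\<close> b] by metis
  have cone: "convex_cone T"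
    using T(1) polyhedral_tangent_cone[OF K]
    by (auto simp: rs_tangent_cones_def tangent_cones_def polyhedral_convex_cone_def)
  have "N (x - u) \<le> r * M (b - y)"
  proof (cases "b - y = 0")
    case True
    then show ?thesis
      using long[of 0] convex_cone_contains_0[OF cone] is_norm_eq_0_iff[OF N, of 0]
        is_norm_eq_0_iff[OF M, of 0] by (simp add: zero_prod_def)
  next
    case False
    have "ereal (N (x - u) / M (b - y)) \<le> inv_norm_on N M (sv_of T) L"
      using T(2) \<open>b - y \<in> L\<close> long
      by (intro preimage_norm_le_inv_norm_on[OF N M L cone _ False]) auto
    also have "\<dots> \<le> hoffman_const N M \<Phi> L"
      unfolding hoffman_const_def using T(1) by (rule SUP_upper)
    finally show ?thesis
      using is_norm_pos[OF M False] by (simp add: r field_simps)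
  qed
  moreover have "dist_set N u (sv_inv \<Phi> b) \<le> ereal (N (x - u))"
    unfolding dist_set_def using x
    by (intro INF_lower2[of x]) (auto simp: sv_inv_def is_norm_minus_commute[OF N])
  ultimately show ?thesis
    by (simp add: dist r order_trans)
qed

text \<open>
  Take a tangent cone \<open>T\<close> and a vector \<open>y\<close> that attain the Hoffman constant \<open>r\<close>, the base point
  \<open>(u, v)\<close> of \<open>T\<close>, and move \<open>v\<close> to \<open>b = v + t *\<^sub>R y\<close>. Since the graph lies in \<open>(u, v) + T\<close>, every
  point of the inverse image of \<open>b\<close> is at distance at least \<open>r * t\<close> from \<open>u\<close>, while \<open>b\<close> is within
  \<open>t\<close> of \<open>v\<close>. The upper error bound, already proved, then forces equality throughout.
\<close>

lemma dist_set_sv_inv_eq: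
  fixes \<Phi> :: "'a::euclidean_space \<Rightarrow> 'b::euclidean_space set"
  assumes N: "is_norm N" and M: "is_norm M" and L: "subspace L" and \<Phi>: "polyhedral_sublinear \<Phi>"
    and pos: "hoffman_const N M \<Phi> L > 0"
  obtains b u where "b \<in> sv_Im \<Phi>" "u \<in> sv_dom \<Phi>"
    "0 < dist_along M L b (\<Phi> u)" "dist_along M L b (\<Phi> u) < \<infinity>"
    "dist_set N u (sv_inv \<Phi> b) = hoffman_const N M \<Phi> L * dist_along M L b (\<Phi> u)"
proof -
  obtain T y r where T: "T \<in> rs_tangent_cones \<Phi>" and y: "y \<in> snd ` T \<inter> L" "M y \<le> 1"
    and r: "hoffman_const N M \<Phi> L = ereal r" and long: "\<And>x. (x, y) \<in> T \<Longrightarrow> r \<le> N x"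
    using hoffman_const_attained[OF N M L \<Phi>] by metis
  have "r > 0" using pos r by simp
  obtain u v where uv: "v \<in> \<Phi> u" and T_eq: "T = tangent_cone (sv_graph \<Phi>) (u, v)"
    using T by (auto simp: rs_tangent_cones_def tangent_cones_def sv_graph_def)
  have "convex_cone T"
    using T polyhedral_tangent_cone \<Phi>
    by (auto simp: rs_tangent_cones_def tangent_cones_def polyhedral_convex_cone_def
        polyhedral_sublinear_def)
  obtain x where "(x, y) \<in> T" using y(1) by auto
  then obtain t where t: "t > 0" "(u, v) + t *\<^sub>R (x, y) \<in> sv_graph \<Phi>"
    by (auto simp: T_eq tangent_cone_def)
  define b where "b = v + t *\<^sub>R y"
  have b: "b \<in> sv_Im \<Phi>" using t(2) by (auto simp: sv_Im_def b_def)
  have u: "u \<in> sv_dom \<Phi>" using uv by (auto simp: sv_dom_def)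
  have "dist_along M L b (\<Phi> u) \<le> ereal (M (b - v))"
    unfolding dist_along_def using uv y(1) L
    by (intro INF_lower) (auto simp: b_def subspace_scale)
  also have "M (b - v) \<le> t"
    using y(2) t(1) by (simp add: b_def is_norm_scaleR[OF M])
  finally have upper: "dist_along M L b (\<Phi> u) \<le> ereal t" by simp
  have nonneg: "0 \<le> dist_along M L b (\<Phi> u)"
    unfolding dist_along_def by (intro INF_greatest) (simp add: is_norm_nonneg[OF M])
  obtain \<delta> where \<delta>: "dist_along M L b (\<Phi> u) = ereal \<delta>" "0 \<le> \<delta>" "\<delta> \<le> t"
    using upper nonneg by (cases "dist_along M L b (\<Phi> u)") auto
  have lower: "ereal (r * t) \<le> dist_set N u (sv_inv \<Phi> b)"
    unfolding dist_set_def
  proof (rule INF_greatest)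
    fix z assume "z \<in> sv_inv \<Phi> b"
    then have "(z, b) - (u, v) \<in> T"
      unfolding T_eq by (intro diff_in_tangent_cone) (simp add: sv_inv_def sv_graph_def)
    from convex_cone_scaleR[OF \<open>convex_cone T\<close> _ this, of "1 / t"]
    have "((1 / t) *\<^sub>R (z - u), y) \<in> T" using t(1) by (simp add: b_def)
    then have "r \<le> (1 / t) * N (u - z)"
      using long is_norm_scaleR[OF N, of "1 / t" "z - u"] is_norm_minus_commute[OF N, of u z] t(1)
      by fastforce
    then show "ereal (r * t) \<le> ereal (N (u - z))"
      using t(1) by (simp add: field_simps)
  qed
  also have "dist_set N u (sv_inv \<Phi> b) \<le> ereal (r * \<delta>)"
    using dist_set_sv_inv_le[OF N M L \<Phi> b, of u] by (simp add: \<delta>(1) r)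
  finally have "r * t \<le> r * \<delta>" by simp
  then have "\<delta> = t" using \<delta>(3) \<open>r > 0\<close> by simp
  then have "dist_set N u (sv_inv \<Phi> b) = ereal (r * t)"
    using lower \<open>dist_set N u (sv_inv \<Phi> b) \<le> ereal (r * \<delta>)\<close> by (simp add: antisym)
  then show thesis
    using that[OF b u] \<delta>(1) \<open>\<delta> = t\<close> t(1) r by simp
qed

theorem theorem1:
  fixes N :: "real ^ 'n \<Rightarrow> real"
    and M :: "real ^ 'm \<Rightarrow> real"
    and \<Phi> :: "real ^ 'n \<Rightarrow> (real ^ 'm) set"
    and L :: "(real ^ 'm) set"
  assumes "is_norm N"
    and "is_norm M"
    and "polyhedral_sublinear \<Phi>"
    and "subspace L"
  shows "(\<forall>b \<in> sv_Im \<Phi>. \<forall>u \<in> sv_dom \<Phi>.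
            dist_set N u (sv_inv \<Phi> b)
              \<le> (if dist_along M L b (\<Phi> u) = \<infinity> then \<infinity>
                  else hoffman_const N M \<Phi> L * dist_along M L b (\<Phi> u)))
       \<and> (hoffman_const N M \<Phi> L > 0 \<longrightarrow>
            (\<exists>b \<in> sv_Im \<Phi>. \<exists>u \<in> sv_dom \<Phi>.
               0 < dist_along M L b (\<Phi> u) \<and> dist_along M L b (\<Phi> u) < \<infinity> \<and>
               dist_set N u (sv_inv \<Phi> b)
                 = hoffman_const N M \<Phi> L * dist_along M L b (\<Phi> u)))"
proof (intro conjI ballI impI)
  fix b u
  assume "b \<in> sv_Im \<Phi>"
  then show "dist_set N u (sv_inv \<Phi> b)
      \<le> (if dist_along M L b (\<Phi> u) = \<infinity> then \<infinity>
          else hoffman_const N M \<Phi> L * dist_along M L b (\<Phi> u))"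
    using dist_set_sv_inv_le[OF assms(1,2,4,3)] by simp
next
  assume "hoffman_const N M \<Phi> L > 0"
  then show "\<exists>b \<in> sv_Im \<Phi>. \<exists>u \<in> sv_dom \<Phi>.
      0 < dist_along M L b (\<Phi> u) \<and> dist_along M L b (\<Phi> u) < \<infinity> \<and>
      dist_set N u (sv_inv \<Phi> b) = hoffman_const N M \<Phi> L * dist_along M L b (\<Phi> u)"
    using dist_set_sv_inv_eq[OF assms(1,2,4,3)] by metis
qed

end
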